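(* Let $r,n$ be positive integers. For every region $\Delta$ of the $r$-Catalan arrangement $\mathcal{C}_n^r$ with $\pi_\Delta$ the identity, and any ${\bm x}\in\Delta$, the sequence ${\bm h}(\Delta)=(h_1(\Delta),\ldots,h_n(\Delta))$ is independent of ${\bm x}$ and is the height sequence of an $r$-Dyck path $P_\Delta$ of length $n$. For a general region $\Delta$, set $P_\Delta:=P_{\pi_\Delta(\Delta)}$. Then the map \[\Phi_n^r:\mathcal{R}(\mathcal{C}_n^r)\to\mathfrak{S}_n\times\mathcal{D}_n^r,\qquad \Phi_n^r(\Delta)=(\pi_\Delta,P_\Delta)\] is a bijection.
   Context: The $r$-Catalan arrangement $\mathcal{C}_n^r$ in $\mathbb{R}^n$ consists of the hyperplanes $x_i-x_j=a$ for $1\le i<j\le n$ and $a\in\{0,\pm1,\ldots,\pm r\}$. Its regions are the connected components of the complement of the union of these hyperplanes, and $\mathcal{R}(\mathcal{C}_n^r)$ is the set of regions. The symmetric group $\mathfrak{S}_n$ acts on $\mathbb{R}^n$ by $\pi({\bm x})=(x_{\pi(1)},\ldots,x_{\pi(n)})$, and this action permutes the regions. For a region $\Delta$, $\pi_\Delta\in\mathfrak{S}_n$ is the unique permutation with $x_{\pi_\Delta(1)}>\cdots>x_{\pi_\Delta(n)}$ for ${\bm x}\in\Delta$. Thus $\pi_\Delta(\Delta)$ is a region on which $x_1>\cdots>x_n$. For ${\bm x}\in\mathbb{R}^n$, let $d_{ijk}({\bm x})=x_i-x_j-k$ if $i\ne j$ and $d_{ijk}({\bm x})=0$ if $i=j$,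 for $i,j\in[n]$ and $k\in[r]$. For $\Delta$ with $\pi_\Delta$ the identity and ${\bm x}\in\Delta$, $h_j(\Delta)$ is the number of pairs $(i,k)\in[n]\times[r]$ with $d_{ijk}({\bm x})>0$. An $r$-Dyck path of length $n$ is a lattice path from $(0,0)$ to $(n,rn)$ with steps $(1,0)$ and $(0,1)$ never going above the line $y=rx$. $\mathcal{D}_n^r$ is the set of such paths. The height sequence of such a path $P$ is $(h_1(P),\ldots,h_n(P))$, where $h_i(P)$ is the $y$-coordinate at which the vertical line $x=i-\frac12$ meets $P$. *)

theory Defs
  imports "HOL-Analysis.Analysis" "HOL-Combinatorics.Permutations"
begin

text \<open>
  Points of $n$-space are the elements of \<^term>\<open>{1..n} \<rightarrow>\<^sub>E (UNIV :: real set)\<close>, which is the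
  carrier of the topology \<^term>\<open>powertop_real {1..n}\<close>; \<open>x i\<close> is the \<open>i\<close>-th coordinate, with
  indices starting at 1.
\<close>

definition catalan_arrangement :: "nat \<Rightarrow> nat \<Rightarrow> (nat \<Rightarrow> real) set set" where
  "catalan_arrangement r n =
     {{x \<in> {1..n} \<rightarrow>\<^sub>E UNIV. x i - x j = of_int a} | i j a.
        1 \<le> i \<and> i < j \<and> j \<le> n \<and> a \<in> {- int r..int r}}"

definition regions :: "nat \<Rightarrow> (nat \<Rightarrow> real) set set \<Rightarrow> (nat \<Rightarrow> real) set set" where
  "regions n A =
     connected_components_of (subtopology (powertop_real {1..n}) (({1..n} \<rightarrow>\<^sub>E UNIV) - \<Union>A))"

definition perm_act :: "nat \<Rightarrow> (nat \<Rightarrow> nat) \<Rightarrow> (nat \<Rightarrow> real) \<Rightarrow> (nat \<Rightarrow> real)" where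
  "perm_act n \<pi> x = (\<lambda>i\<in>{1..n}. x (\<pi> i))"

definition region_perm :: "nat \<Rightarrow> (nat \<Rightarrow> real) set \<Rightarrow> (nat \<Rightarrow> nat)" where
  "region_perm n \<Delta> =
     (THE \<pi>. \<pi> permutes {1..n} \<and> (\<forall>x\<in>\<Delta>. \<forall>i\<in>{1..n}. \<forall>j\<in>{1..n}. i < j \<longrightarrow> x (\<pi> i) > x (\<pi> j)))"

definition diff_val :: "nat \<Rightarrow> nat \<Rightarrow> nat \<Rightarrow> (nat \<Rightarrow> real) \<Rightarrow> real" where
  "diff_val i j k x = (if i = j then 0 else x i - x j - real k)"

text \<open>The sequence $(h_1, \ldots, h_n)$ computed from a single point \<open>x\<close> of a region.\<close>

definition point_heights :: "nat \<Rightarrow> nat \<Rightarrow> (nat \<Rightarrow> real) \<Rightarrow> nat list" where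
  "point_heights r n x =
     map (\<lambda>j. card {(i, k). i \<in> {1..n} \<and> k \<in> {1..r} \<and> diff_val i j k x > 0}) [1..<Suc n]"

text \<open>
  The choice of the point is immaterial when the permutation of \<open>\<Delta>\<close> is the identity; only such
  regions are of interest here.
\<close>

definition region_heights :: "nat \<Rightarrow> nat \<Rightarrow> (nat \<Rightarrow> real) set \<Rightarrow> nat list" where
  "region_heights r n \<Delta> = point_heights r n (SOME x. x \<in> \<Delta>)"

text \<open>
  A lattice path is the list of the lattice points it visits; \<open>path_trace\<close> is the corresponding
  polygonal line in the plane.
\<close>

definition lattice_path :: "(nat \<times> nat) list \<Rightarrow> bool" where
  "lattice_path P \<longleftrightarrow>
     P \<noteq> [] \<and> successively (\<lambda>p q. q = (fst p + 1, snd p) \<or> q = (fst p, snd p + 1)) P"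

definition real_point :: "nat \<times> nat \<Rightarrow> real \<times> real" where
  "real_point p = (real (fst p), real (snd p))"

definition path_trace :: "(nat \<times> nat) list \<Rightarrow> (real \<times> real) set" where
  "path_trace P = (\<Union>i<length P - 1. closed_segment (real_point (P ! i)) (real_point (P ! Suc i)))"

definition dyck_paths :: "nat \<Rightarrow> nat \<Rightarrow> (nat \<times> nat) list set" where
  "dyck_paths r n =
     {P. lattice_path P \<and> hd P = (0, 0) \<and> last P = (n, r * n) \<and>
         (\<forall>(x, y)\<in>path_trace P. y \<le> real r * x)}"

definition height_sequence :: "nat \<Rightarrow> (nat \<times> nat) list \<Rightarrow> real list" where
  "height_sequence n P = map (\<lambda>i. THE y. (real i - 1/2, y) \<in> path_trace P) [1..<Suc n]"

text \<open>The path of a region whose permutation is the identity.\<close>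

definition path_of_id_region :: "nat \<Rightarrow> nat \<Rightarrow> (nat \<Rightarrow> real) set \<Rightarrow> (nat \<times> nat) list" where
  "path_of_id_region r n \<Delta> =
     (THE P. P \<in> dyck_paths r n \<and> height_sequence n P = map real (region_heights r n \<Delta>))"

definition region_path :: "nat \<Rightarrow> nat \<Rightarrow> (nat \<Rightarrow> real) set \<Rightarrow> (nat \<times> nat) list" where
  "region_path r n \<Delta> = path_of_id_region r n (perm_act n (region_perm n \<Delta>) ` \<Delta>)"

definition Phi :: "nat \<Rightarrow> nat \<Rightarrow> (nat \<Rightarrow> real) set \<Rightarrow> (nat \<Rightarrow> nat) \<times> (nat \<times> nat) list" where
  "Phi r n \<Delta> = (region_perm n \<Delta>, region_path r n \<Delta>)"

end

theory Submission
  imports Defs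
begin

text \<open>
  Two points off the arrangement lie in the same region iff they are on the same side of every
  hyperplane, so in the chamber \<open>x\<^sub>1 > \<dots> > x\<^sub>n\<close> a region amounts to the truth values of
  \<open>x\<^sub>i - x\<^sub>j > k\<close> for \<open>i < j\<close> and \<open>1 \<le> k \<le> r\<close>. The height \<open>h\<^sub>j\<close> counts the shifts \<open>x\<^sub>i - k\<close> with
  \<open>i < j\<close> that lie above \<open>x\<^sub>j\<close>. The relative order of these shifts is decided by the signs for the
  indices below \<open>j\<close>, so \<open>h\<^sub>j\<close> says into which gap between them \<open>x\<^sub>j\<close> falls, and hence, by
  induction on \<open>j\<close>, the heights determine the region. Conversely, \<open>x\<^sub>j\<close> can be put into any
  prescribed gap, and below \<open>x\<^sub>j\<^sub>-\<^sub>1\<close> exactly when \<open>h\<^sub>j \<ge> h\<^sub>j\<^sub>-\<^sub>1\<close>; so the sequences that occur are the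
  weakly increasing ones with \<open>h\<^sub>j \<le> r (j - 1)\<close>, the height sequences of \<open>r\<close>-Dyck paths.
\<close>

section \<open>Lattice paths and their heights\<close>

text \<open>
  The coordinates of the \<open>t\<close>-th point of a path from the origin sum to \<open>t\<close>, so the horizontal step
  from \<open>(i, b)\<close> can only occur at position \<open>i + b\<close>.
\<close>

definition crosses :: "(nat \<times> nat) list \<Rightarrow> nat \<Rightarrow> nat \<Rightarrow> bool" where
  "crosses P i b \<longleftrightarrow> Suc (i + b) < length P \<and> P ! (i + b) = (i, b) \<and> P ! Suc (i + b) = (Suc i, b)"

lemma lattice_path_step:
  assumes "lattice_path P" "Suc t < length P"
  shows "P ! Suc t = (Suc (fst (P ! t)), snd (P ! t)) \<or> P ! Suc t = (fst (P ! t), Suc (snd (P ! t)))"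
  using assms by (auto simp: lattice_path_def successively_conv_nth)

lemma lattice_path_coord_sum:
  assumes "lattice_path P" "hd P = (0, 0)" "t < length P"
  shows "fst (P ! t) + snd (P ! t) = t"
  using assms(3)
proof (induction t)
  case 0
  then show ?case using assms by (simp add: lattice_path_def hd_conv_nth)
next
  case (Suc t)
  then show ?case using lattice_path_step[OF assms(1) Suc.prems] by auto
qed

lemma lattice_path_length:
  assumes "lattice_path P" "hd P = (0, 0)" "last P = (n, m)"
  shows "length P = Suc (n + m)"
proof -
  have "P \<noteq> []" using assms by (simp add: lattice_path_def)
  then show ?thesis
    using lattice_path_coord_sum[OF assms(1,2), of "length P - 1"] assms(3)
    by (simp add: last_conv_nth)
qed

lemma lattice_path_nth_last:
  assumes "lattice_path P" "hd P = (0, 0)" "last P = (n, m)"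
  shows "P ! (n + m) = (n, m)"
proof -
  have "P \<noteq> []" using assms by (simp add: lattice_path_def)
  then show ?thesis using assms(3) lattice_path_length[OF assms] by (simp add: last_conv_nth)
qed

lemma lattice_path_fst_mono:
  assumes "lattice_path P" "s \<le> t" "t < length P"
  shows "fst (P ! s) \<le> fst (P ! t)"
  using assms(2,3)
proof (induction t rule: dec_induct)
  case base
  then show ?case by simp
next
  case (step t)
  then show ?case using lattice_path_step[OF assms(1) step.prems] by fastforce
qed

lemma crossesI:
  assumes "lattice_path P" "hd P = (0, 0)" "Suc t < length P"
    and "P ! t = (i, b)" "P ! Suc t = (Suc i, b)"
  shows "crosses P i b"
  using assms lattice_path_coord_sum[OF assms(1,2), of t] by (auto simp: crosses_def)

lemma crosses_unique:
  assumes "lattice_path P" "crosses P i b" "crosses P i b'"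
  shows "b = b'"
proof -
  have "\<not> c < d" if "crosses P i c" "crosses P i d" for c d
    using that lattice_path_fst_mono[OF assms(1), of "Suc (i + c)" "i + d"]
    by (auto simp: crosses_def)
  then show ?thesis using assms by (metis linorder_neqE_nat)
qed

lemma unit_steps_crossing:
  fixes f :: "nat \<Rightarrow> nat"
  assumes "f 0 \<le> i" "i < f N" "\<And>t. t < N \<Longrightarrow> f (Suc t) \<le> Suc (f t)"
  shows "\<exists>t<N. f t = i \<and> f (Suc t) = Suc i"
  using assms
proof (induction N)
  case (Suc N)
  show ?case
  proof (cases "i < f N")
    case True
    then show ?thesis using Suc by (meson less_SucI)
  next
    case False
    then have "f N = i \<and> f (Suc N) = Suc i" using Suc.prems(2) Suc.prems(3)[of N] by simp
    then show ?thesis by blast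
  qed
qed simp

lemma crosses_exists:
  assumes "lattice_path P" "hd P = (0, 0)" "last P = (n, m)" "i < n"
  shows "\<exists>b. crosses P i b"
proof -
  note len = lattice_path_length[OF assms(1-3)]
  have "P \<noteq> []" using assms by (simp add: lattice_path_def)
  then have ends: "P ! 0 = (0, 0)" "P ! (n + m) = (n, m)"
    using assms(2,3) len by (auto simp: hd_conv_nth last_conv_nth)
  have st: "P ! Suc t = (Suc (fst (P ! t)), snd (P ! t)) \<or> P ! Suc t = (fst (P ! t), Suc (snd (P ! t)))"
    if "t < n + m" for t using lattice_path_step[OF assms(1), of t] that len by simp
  have "fst (P ! Suc t) \<le> Suc (fst (P ! t))" if "t < n + m" for t using st[OF that] by auto
  then obtain t where t: "t < n + m" "fst (P ! t) = i" "fst (P ! Suc t) = Suc i"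
    using unit_steps_crossing[of "\<lambda>t. fst (P ! t)" i "n + m"] ends assms(4) by auto
  then have "crosses P i (snd (P ! t))"
    using st[OF t(1)] len by (intro crossesI[OF assms(1,2), of t]) (auto simp: prod_eq_iff)
  then show ?thesis by blast
qed

lemma path_trace_crossing:
  assumes "lattice_path P" "hd P = (0, 0)"
  shows "(real (Suc i) - 1/2, y) \<in> path_trace P \<longleftrightarrow> (\<exists>b. y = real b \<and> crosses P i b)"
proof
  assume "(real (Suc i) - 1/2, y) \<in> path_trace P"
  then obtain t where t: "Suc t < length P"
    and "(real (Suc i) - 1/2, y) \<in> closed_segment (real_point (P ! t)) (real_point (P ! Suc t))"
    unfolding path_trace_def by (metis (no_types, lifting) UN_E lessThan_iff less_diff_conv add.commute plus_1_eq_Suc)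
  then obtain u where u: "0 \<le> u" "u \<le> 1"
    and eq: "(real (Suc i) - 1/2, y) = (1 - u) *\<^sub>R real_point (P ! t) + u *\<^sub>R real_point (P ! Suc t)"
    by (auto simp: closed_segment_def)
  obtain a b where ab: "P ! t = (a, b)" by fastforce
  from lattice_path_step[OF assms(1) t] have "P ! Suc t = (Suc a, b) \<or> P ! Suc t = (a, Suc b)"
    by (simp add: ab)
  then show "\<exists>b. y = real b \<and> crosses P i b"
  proof
    assume h: "P ! Suc t = (Suc a, b)"
    have e: "real i + 1/2 = real a + u" "y = real b"
      using eq by (simp_all add: h ab real_point_def algebra_simps)
    then have "real i < real a + 1" "real a < real i + 1" using u by linarith+
    then have "a = i" by linarith
    then show ?thesis using crossesI[OF assms t] h ab e by blast
  next
    assume "P ! Suc t = (a, Suc b)"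
    then have "real i + 1/2 = real a" using eq by (simp add: ab real_point_def algebra_simps)
    then have "real (2 * i + 1) = real (2 * a)" by simp
    then have "2 * i + 1 = 2 * a" using of_nat_eq_iff by blast
    then show ?thesis by presburger
  qed
next
  assume "\<exists>b. y = real b \<and> crosses P i b"
  then obtain b where b: "y = real b" "Suc (i + b) < length P" "P ! (i + b) = (i, b)"
    "P ! Suc (i + b) = (Suc i, b)" by (auto simp: crosses_def)
  have "(real (Suc i) - 1/2, y) \<in> closed_segment (real_point (P ! (i + b))) (real_point (P ! Suc (i + b)))"
    unfolding closed_segment_def using b
    by (auto simp: real_point_def algebra_simps intro!: exI[of _ "1/2"])
  then show "(real (Suc i) - 1/2, y) \<in> path_trace P"
    using b(2) by (auto simp: path_trace_def intro!: bexI[of _ "i + b"])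
qed

lemma height_sequence_eq_iff:
  assumes "lattice_path P" "hd P = (0, 0)" "last P = (n, m)"
  shows "height_sequence n P = map (\<lambda>j. real (h j)) [1..<Suc n] \<longleftrightarrow> (\<forall>i<n. crosses P i (h (Suc i)))"
proof -
  have the: "(THE y. (real (Suc i) - 1/2, y) \<in> path_trace P) = real b" if "crosses P i b" for i b
    unfolding path_trace_crossing[OF assms(1,2)]
    using that crosses_unique[OF assms(1)] by (intro the_equality) auto
  have iff: "(THE y. (real (Suc i) - 1/2, y) \<in> path_trace P) = real b \<longleftrightarrow> crosses P i b" if "i < n" for i b
    using crosses_exists[OF assms that] the[of i] by fastforce
  have "height_sequence n P = map (\<lambda>j. real (h j)) [1..<Suc n] \<longleftrightarrow>
     (\<forall>j\<in>{1..n}. (THE y. (real j - 1/2, y) \<in> path_trace P) = real (h j))"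
    unfolding height_sequence_def by (auto simp: atLeastLessThanSuc_atLeastAtMost simp del: upt_Suc)
  also have "\<dots> \<longleftrightarrow> (\<forall>i<n. (THE y. (real (Suc i) - 1/2, y) \<in> path_trace P) = real (h (Suc i)))"
    by (metis Suc_leI One_nat_def Suc_le_D Suc_le_lessD atLeastAtMost_iff le_add1 plus_1_eq_Suc)
  finally show ?thesis using iff by simp
qed

lemma lattice_path_eqI:
  assumes "lattice_path P" "hd P = (0, 0)" "last P = (n, m)"
    and "lattice_path Q" "hd Q = (0, 0)" "last Q = (n, m)"
    and "\<forall>i<n. crosses P i (h i)" "\<forall>i<n. crosses Q i (h i)"
  shows "P = Q"
proof -
  note len = lattice_path_length[OF assms(1-3)] lattice_path_length[OF assms(4-6)]
  have horiz: "B ! Suc t = (Suc a, b)"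
    if "lattice_path A" "hd A = (0, 0)" "last A = (n, m)" "length A = Suc (n + m)"
      "\<forall>i<n. crosses A i (h i)" "\<forall>i<n. crosses B i (h i)"
      "Suc t < Suc (n + m)" "A ! t = (a, b)" "A ! Suc t = (Suc a, b)" for A B t a b
  proof -
    have c: "crosses A a b" using crossesI that by metis
    have "A ! (n + m) = (n, m)" by (rule lattice_path_nth_last[OF that(1-3)])
    then have "a < n" using lattice_path_fst_mono[OF that(1), of "Suc t" "n + m"] that by simp
    then have "b = h a" "crosses B a (h a)" using c crosses_unique[OF that(1)] that by blast+
    then show ?thesis
      using lattice_path_coord_sum[OF that(1,2), of t] that by (auto simp: crosses_def)
  qed
  have "P ! t = Q ! t" if "t < Suc (n + m)" for t
    using that
  proof (induction t)
    case 0
    then show ?case using assms by (metis hd_conv_nth lattice_path_def)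
  next
    case (Suc t)
    obtain a b where ab: "P ! t = (a, b)" "Q ! t = (a, b)" using Suc by (metis Suc_lessD prod.exhaust)
    have P: "P ! Suc t = (Suc a, b) \<or> P ! Suc t = (a, Suc b)"
      using lattice_path_step[OF assms(1), of t] ab Suc.prems len by simp
    have Q: "Q ! Suc t = (Suc a, b) \<or> Q ! Suc t = (a, Suc b)"
      using lattice_path_step[OF assms(4), of t] ab Suc.prems len by simp
    show ?case
      using P Q horiz[OF assms(1-3) len(1) assms(7,8) Suc.prems ab(1)]
        horiz[OF assms(4-6) len(2) assms(8,7) Suc.prems ab(2)] by metis
  qed
  then show ?thesis using len by (intro nth_equalityI) auto
qed

lemma lattice_path_exists:
  assumes bnd: "\<And>i. i < n \<Longrightarrow> h i \<le> m" and mono: "\<And>i j. i \<le> j \<Longrightarrow> j < n \<Longrightarrow> h i \<le> h j"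
  shows "\<exists>P. lattice_path P \<and> hd P = (0, 0) \<and> last P = (n, m) \<and> (\<forall>i<n. crosses P i (h i))"
proof -
  \<comment> \<open>The \<open>i\<close>-th horizontal step starts on the antidiagonal \<open>x + y = i + h i\<close>, so \<open>c t\<close> is the
    abscissa of the \<open>t\<close>-th point.\<close>
  define c where "c t = card {i. i < n \<and> i + h i < t}" for t
  define P where "P = map (\<lambda>t. (c t, t - c t)) [0..<Suc (n + m)]"
  have len: "length P = Suc (n + m)" by (simp add: P_def)
  have nth: "P ! t = (c t, t - c t)" if "t < Suc (n + m)" for t
    using that nth_map_upt[of t "Suc (n + m)" 0] by (simp add: P_def del: upt_Suc)
  have smono: "i + h i < j + h j" if "i < j" "j < n" for i j
    using mono[of i j] that by simp
  have split: "{i. i < n \<and> i + h i < Suc t} = {i. i < n \<and> i + h i < t} \<union> {i. i < n \<and> i + h i = t}" for t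
    by auto
  have one: "{i. i < n \<and> i + h i = t} = {} \<or> (\<exists>j. {i. i < n \<and> i + h i = t} = {j})" for t
  proof -
    have "i = j" if "i < n" "j < n" "i + h i = t" "j + h j = t" for i j
      using smono[of i j] smono[of j i] that by (cases i j rule: linorder_cases) auto
    then show ?thesis by blast
  qed
  have step: "c (Suc t) = c t \<or> c (Suc t) = Suc (c t)" for t
  proof -
    have "c (Suc t) = c t + card {i. i < n \<and> i + h i = t}"
      unfolding c_def split by (intro card_Un_disjoint) auto
    moreover have "card {i. i < n \<and> i + h i = t} \<in> {0, 1}" using one[of t] by (elim disjE exE) simp_all
    ultimately show ?thesis by auto
  qed
  have c0: "c 0 = 0" by (simp add: c_def)
  have cle: "c t \<le> t" for t
  proof (induction t)
    case 0 then show ?case by (simp add: c0)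
  next
    case (Suc t) then show ?case using step[of t] by auto
  qed
  have smono_iff: "j + h j < i + h i \<longleftrightarrow> j < i" if "i < n" "j < n" for i j
    using smono[of i j] smono[of j i] that by (cases i j rule: linorder_cases) simp_all
  have smono_le_iff: "j + h j \<le> i + h i \<longleftrightarrow> j \<le> i" if "i < n" "j < n" for i j
    using smono_iff[of j i] that by linarith
  have at: "c (i + h i) = i" if "i < n" for i
  proof -
    have "{j. j < n \<and> j + h j < i + h i} = {..<i}"
      using smono_iff[OF that] that by (intro set_eqI) (metis lessThan_iff less_trans mem_Collect_eq)
    then show ?thesis by (simp add: c_def)
  qed
  have after: "c (Suc (i + h i)) = Suc i" if "i < n" for i
  proof -
    have "{j. j < n \<and> j + h j < Suc (i + h i)} = {..i}"
      using smono_le_iff[OF that] that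
      by (intro set_eqI) (metis atMost_iff le_less_trans less_Suc_eq_le mem_Collect_eq)
    then show ?thesis by (simp add: c_def)
  qed
  have fin: "c (n + m) = n"
  proof -
    have "{i. i < n \<and> i + h i < n + m} = {..<n}" using bnd by (auto simp: add_less_le_mono)
    then show ?thesis by (simp add: c_def)
  qed
  have "lattice_path P"
    unfolding lattice_path_def successively_conv_nth
  proof (intro conjI allI impI)
    show "P \<noteq> []" by (simp add: P_def)
    fix t assume "Suc t < length P"
    then show "P ! Suc t = (fst (P ! t) + 1, snd (P ! t)) \<or> P ! Suc t = (fst (P ! t), snd (P ! t) + 1)"
      using step[of t] cle[of t] by (auto simp: nth len Suc_diff_le)
  qed
  moreover have "hd P = (0, 0)" using nth[of 0] len by (simp add: hd_conv_nth c0 P_def del: upt_Suc)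
  moreover have "last P = (n, m)" using nth[of "n + m"] len fin by (simp add: last_conv_nth P_def del: upt_Suc)
  moreover have "crosses P i (h i)" if "i < n" for i
  proof -
    have "Suc (i + h i) < Suc (n + m)" using bnd[OF that] that by simp
    then show ?thesis using at[OF that] after[OF that] by (simp add: crosses_def nth len)
  qed
  ultimately show ?thesis by blast
qed

lemma lattice_path_point_below_crossing:
  assumes "lattice_path P" "hd P = (0, 0)" "t < length P" "P ! t = (a, b)" "crosses P a c"
  shows "b \<le> c"
proof (rule ccontr)
  assume "\<not> b \<le> c"
  moreover have "a + b = t" using lattice_path_coord_sum[OF assms(1-3)] assms(4) by simp
  ultimately have "fst (P ! Suc (a + c)) \<le> fst (P ! t)"
    using assms by (intro lattice_path_fst_mono[OF assms(1)]) auto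
  then show False using assms by (simp add: crosses_def)
qed

lemma path_trace_subset_convex:
  assumes "convex S" "\<And>t. t < length P \<Longrightarrow> real_point (P ! t) \<in> S"
  shows "path_trace P \<subseteq> S"
  unfolding path_trace_def
  using assms(2) by (intro UN_least closed_segment_subset[OF _ _ assms(1)]) auto

lemma below_line_iff_crossings:
  assumes "lattice_path P" "hd P = (0, 0)" "last P = (n, r * n)" "\<forall>i<n. crosses P i (h i)"
  shows "(\<forall>(x, y)\<in>path_trace P. y \<le> real r * x) \<longleftrightarrow> (\<forall>i<n. h i \<le> r * i)"
proof
  assume below: "\<forall>(x, y)\<in>path_trace P. y \<le> real r * x"
  show "\<forall>i<n. h i \<le> r * i"
  proof (intro allI impI)
    fix i assume "i < n"
    then have c: "Suc (i + h i) < length P" "P ! (i + h i) = (i, h i)"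
      using assms(4) by (auto simp: crosses_def)
    then have "real_point (P ! (i + h i)) \<in> path_trace P"
      unfolding path_trace_def by (intro UN_I[of "i + h i"]) auto
    then have "real (h i) \<le> real r * real i" using below c by (auto simp: real_point_def)
    then show "h i \<le> r * i" using of_nat_le_iff[where 'a = real] by (metis of_nat_mult)
  qed
next
  assume h: "\<forall>i<n. h i \<le> r * i"
  let ?S = "{p :: real \<times> real. (- real r, 1) \<bullet> p \<le> 0}"
  note len = lattice_path_length[OF assms(1-3)]
  note P_last = lattice_path_nth_last[OF assms(1-3)]
  have "real_point (P ! t) \<in> ?S" if t: "t < length P" for t
  proof -
    obtain a b where ab: "P ! t = (a, b)" by fastforce
    have "a \<le> n" using lattice_path_fst_mono[OF assms(1), of t "n + r * n"] t len P_last ab by simp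
    have "b \<le> r * a"
    proof (cases "a = n")
      case True
      then show ?thesis using lattice_path_coord_sum[OF assms(1,2) t] t len ab by simp
    next
      case False
      then have "a < n" using \<open>a \<le> n\<close> by simp
      then show ?thesis
        using lattice_path_point_below_crossing[OF assms(1,2) t ab] assms(4) h by (meson le_trans)
    qed
    then have "real b \<le> real r * real a" by (metis of_nat_le_iff of_nat_mult)
    then show ?thesis by (simp add: ab real_point_def)
  qed
  then have "path_trace P \<subseteq> ?S" by (intro path_trace_subset_convex convex_halfspace_le)
  then show "\<forall>(x, y)\<in>path_trace P. y \<le> real r * x" by auto
qed

definition dyck_heights :: "nat \<Rightarrow> nat \<Rightarrow> (nat \<Rightarrow> nat) \<Rightarrow> bool" where
  "dyck_heights r n h \<longleftrightarrow> (\<forall>i<n. h (Suc i) \<le> r * i) \<and> (\<forall>i j. i \<le> j \<longrightarrow> j < n \<longrightarrow> h (Suc i) \<le> h (Suc j))"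

lemma dyck_path_of_heights:
  assumes "dyck_heights r n h"
  shows "\<exists>!P. P \<in> dyck_paths r n \<and> height_sequence n P = map (\<lambda>j. real (h j)) [1..<Suc n]"
proof -
  have b: "h (Suc i) \<le> r * n" if "i < n" for i
    using assms that by (meson dyck_heights_def less_imp_le le_trans mult_le_mono2)
  obtain P where P: "lattice_path P" "hd P = (0, 0)" "last P = (n, r * n)" "\<forall>i<n. crosses P i (h (Suc i))"
    using lattice_path_exists[of n "\<lambda>i. h (Suc i)" "r * n"] b assms unfolding dyck_heights_def by blast
  have "P \<in> dyck_paths r n \<and> height_sequence n P = map (\<lambda>j. real (h j)) [1..<Suc n]"
    using P below_line_iff_crossings[OF P] height_sequence_eq_iff[OF P(1-3)] assms
    by (simp add: dyck_paths_def dyck_heights_def del: upt_Suc)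
  moreover have "Q = P" if "Q \<in> dyck_paths r n" "height_sequence n Q = map (\<lambda>j. real (h j)) [1..<Suc n]" for Q
  proof -
    have Q: "lattice_path Q" "hd Q = (0, 0)" "last Q = (n, r * n)" using that by (auto simp: dyck_paths_def)
    show ?thesis
      using lattice_path_eqI[OF Q P(1-3), of "\<lambda>i. h (Suc i)"] P(4) height_sequence_eq_iff[OF Q, of h] that by blast
  qed
  ultimately show ?thesis by blast
qed

lemma dyck_path_heights:
  assumes "P \<in> dyck_paths r n"
  shows "\<exists>h. dyck_heights r n h \<and> height_sequence n P = map (\<lambda>j. real (h j)) [1..<Suc n]"
proof -
  have P: "lattice_path P" "hd P = (0, 0)" "last P = (n, r * n)" using assms by (auto simp: dyck_paths_def)
  obtain g where g: "\<forall>i<n. crosses P i (g i)" using crosses_exists[OF P] by metis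
  let ?h = "\<lambda>j. g (j - 1)"
  have "g i \<le> r * i" if "i < n" for i
    using below_line_iff_crossings[OF P g] assms that by (simp add: dyck_paths_def)
  moreover have "g i \<le> g j" if "i \<le> j" "j < n" for i j
  proof (cases "i = j")
    case False
    have "crosses P i (g i)" "crosses P j (g j)" using g that by auto
    then have "\<not> j + g j < Suc (i + g i)"
      using lattice_path_fst_mono[OF P(1), of "j + g j" "i + g i"] that False
      by (auto simp: crosses_def)
    then have le: "Suc (i + g i) \<le> j + g j" by simp
    have "snd (P ! s) \<le> snd (P ! t)" if "s \<le> t" "t < length P" for s t
      using that
    proof (induction t rule: dec_induct)
      case (step t)
      then show ?case using lattice_path_step[OF P(1) step.prems] by fastforce
    qed simp
    from this[OF le] show ?thesis using \<open>crosses P i (g i)\<close> \<open>crosses P j (g j)\<close>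
      by (simp add: crosses_def)
  qed simp
  ultimately have "dyck_heights r n ?h" by (simp add: dyck_heights_def)
  moreover have "height_sequence n P = map (\<lambda>j. real (?h j)) [1..<Suc n]"
    using height_sequence_eq_iff[OF P, of ?h] g by simp
  ultimately show ?thesis by blast
qed

section \<open>Points of the dominant chamber\<close>

definition dominant :: "nat \<Rightarrow> nat \<Rightarrow> (nat \<Rightarrow> real) \<Rightarrow> bool" where
  "dominant r n x \<longleftrightarrow> (\<forall>i j. 1 \<le> i \<longrightarrow> i < j \<longrightarrow> j \<le> n \<longrightarrow> x j < x i) \<and>
     (\<forall>i j k. 1 \<le> i \<longrightarrow> i < j \<longrightarrow> j \<le> n \<longrightarrow> 1 \<le> k \<longrightarrow> k \<le> r \<longrightarrow> x i - x j \<noteq> real k)"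

lemma dominant_less: "dominant r n x \<Longrightarrow> 1 \<le> i \<Longrightarrow> i < j \<Longrightarrow> j \<le> n \<Longrightarrow> x j < x i"
  unfolding dominant_def by blast

lemma dominant_neq:
  "dominant r n x \<Longrightarrow> 1 \<le> i \<Longrightarrow> i < j \<Longrightarrow> j \<le> n \<Longrightarrow> 1 \<le> k \<Longrightarrow> k \<le> r \<Longrightarrow> x i - x j \<noteq> real k"
  unfolding dominant_def by blast

lemma dominant_le:
  assumes "dominant r n x" "1 \<le> i" "i \<le> j" "j \<le> n"
  shows "x j \<le> x i"
  using dominant_less[OF assms(1,2) _ assms(4)] assms(3) by (cases "i = j") auto

definition shifts_above :: "nat \<Rightarrow> (nat \<Rightarrow> real) \<Rightarrow> nat \<Rightarrow> (nat \<times> nat) set" where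
  "shifts_above r x j = {(i, k). i \<in> {1..<j} \<and> k \<in> {1..r} \<and> x i - real k > x j}"

lemma shifts_above_subset: "shifts_above r x j \<subseteq> {1..<j} \<times> {1..r}"
  by (auto simp: shifts_above_def)

lemma finite_shifts_above [simp]: "finite (shifts_above r x j)"
  using shifts_above_subset by (rule finite_subset) simp

lemma point_heights_dominant:
  assumes "dominant r n x"
  shows "point_heights r n x = map (\<lambda>j. card (shifts_above r x j)) [1..<Suc n]"
proof -
  have "{(i, k). i \<in> {1..n} \<and> k \<in> {1..r} \<and> diff_val i j k x > 0} = shifts_above r x j" if j: "j \<in> {1..n}" for j
  proof -
    have "diff_val i j k x > 0 \<longleftrightarrow> i < j \<and> x i - real k > x j" if "i \<in> {1..n}" "k \<in> {1..r}" for i k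
    proof (cases i j rule: linorder_cases)
      case greater
      then have "x i < x j" using dominant_less[OF assms, of j i] j that by simp
      then show ?thesis using that greater by (simp add: diff_val_def)
    next
      case less
      then show ?thesis by (simp add: diff_val_def) linarith
    qed (simp add: diff_val_def)
    moreover have "{1..<j} \<subseteq> {1..n}" using j by auto
    ultimately show ?thesis using j unfolding shifts_above_def by (intro set_eqI) auto
  qed
  then show ?thesis unfolding point_heights_def by (intro map_cong) auto
qed

lemma dyck_heights_dominant:
  assumes "dominant r n x"
  shows "dyck_heights r n (\<lambda>j. card (shifts_above r x j))"
  unfolding dyck_heights_def
proof (intro conjI allI impI)
  fix i
  show "card (shifts_above r x (Suc i)) \<le> r * i"
  proof -
    have "card (shifts_above r x (Suc i)) \<le> card ({1..<Suc i} \<times> {1..r})"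
      by (intro card_mono shifts_above_subset) simp
    then show ?thesis by (simp add: card_cartesian_product mult.commute)
  qed
next
  fix i j assume "i \<le> j" "j < n"
  then have "x (Suc j) \<le> x (Suc i)"
    using dominant_le[OF assms] by simp
  then have "shifts_above r x (Suc i) \<subseteq> shifts_above r x (Suc j)"
    using \<open>i \<le> j\<close> by (auto simp: shifts_above_def)
  then show "card (shifts_above r x (Suc i)) \<le> card (shifts_above r x (Suc j))"
    by (intro card_mono) auto
qed

lemma dominant_shift_less_iff:
  assumes x: "dominant r n x" and y: "dominant r n y"
    and agree: "\<And>i j k. 1 \<le> i \<Longrightarrow> i < j \<Longrightarrow> j \<le> n \<Longrightarrow> 1 \<le> k \<Longrightarrow> k \<le> r \<Longrightarrow>
      x i - x j > real k \<longleftrightarrow> y i - y j > real k"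
    and "i \<in> {1..n}" "i' \<in> {1..n}" "k \<in> {1..r}" "k' \<in> {1..r}"
    and "x i' - real k' < x i - real k"
  shows "y i' - real k' < y i - real k"
proof (cases i i' rule: linorder_cases)
  case less
  have "y i' < y i" using dominant_less[OF y, of i i'] less assms(4,5) by simp
  moreover have "y i - y i' > real (k - k')" if "k' < k"
  proof -
    have "x i - x i' > real (k - k')" using that assms(8) by (simp add: of_nat_diff)
    then show ?thesis using agree[of i i' "k - k'"] less that assms(4-7) by simp
  qed
  ultimately show ?thesis by (cases "k' < k") (simp_all add: of_nat_diff)
next
  case equal
  then show ?thesis using assms(8) by simp
next
  case greater
  have "x i < x i'" using dominant_less[OF x, of i' i] greater assms(4,5) by simp
  then have kk: "k < k'" using assms(8) by simp
  then have range: "1 \<le> k' - k" "k' - k \<le> r" using assms(7) by auto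
  have "\<not> x i' - x i > real (k' - k)" using assms(8) kk by (simp add: of_nat_diff)
  then have "\<not> y i' - y i > real (k' - k)" using agree[of i' i "k' - k"] greater range assms(4,5) by simp
  moreover have "y i' - y i \<noteq> real (k' - k)"
    using dominant_neq[OF y, of i' i "k' - k"] greater range assms(4,5) by simp
  ultimately show ?thesis using kk by (simp add: of_nat_diff)
qed

lemma dominant_mono: "dominant r n x \<Longrightarrow> m \<le> n \<Longrightarrow> dominant r m x"
  by (auto simp: dominant_def)

lemma dominant_agree_if_heights_eq:
  assumes "dominant r n x" "dominant r n y"
    and "\<And>j. j \<in> {1..n} \<Longrightarrow> card (shifts_above r x j) = card (shifts_above r y j)"
    and "1 \<le> i" "i < j" "j \<le> n" "1 \<le> k" "k \<le> r"
  shows "x i - x j > real k \<longleftrightarrow> y i - y j > real k"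
  using assms(4-8)
proof (induction j arbitrary: i k rule: less_induct)
  case (less j)
  let ?m = "j - 1"
  have m: "?m \<le> n" using less.prems by simp
  note dom = dominant_mono[OF assms(1) m] dominant_mono[OF assms(2) m]
  have agree: "x a - x b > real c \<longleftrightarrow> y a - y b > real c"
    if "1 \<le> a" "a < b" "b \<le> ?m" "1 \<le> c" "c \<le> r" for a b c
    using less.IH[of b a c] that less.prems by simp
  \<comment> \<open>Both sets are initial segments, of equal size, in the same linear order on shifts.\<close>
  have "shifts_above r x j \<subseteq> shifts_above r y j \<or> shifts_above r y j \<subseteq> shifts_above r x j"
  proof (rule ccontr)
    assume "\<not> ?thesis"
    then obtain a k b l where *: "(a, k) \<in> shifts_above r x j" "(a, k) \<notin> shifts_above r y j"
      "(b, l) \<in> shifts_above r y j" "(b, l) \<notin> shifts_above r x j" by (metis subsetI surj_pair)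
    then have range: "a \<in> {1..?m}" "b \<in> {1..?m}" "k \<in> {1..r}" "l \<in> {1..r}"
      by (simp_all add: shifts_above_def) linarith+
    have "x b - real l < x a - real k" "y a - real k < y b - real l"
      using * unfolding shifts_above_def by (simp_all add: not_less)
    then show False using dominant_shift_less_iff[OF dom agree range] by fastforce
  qed
  then have "shifts_above r x j = shifts_above r y j"
    using assms(3)[of j] less.prems by (metis atLeastAtMost_iff card_subset_eq finite_shifts_above le_trans less_imp_le)
  then have "(i, k) \<in> shifts_above r x j \<longleftrightarrow> (i, k) \<in> shifts_above r y j" by simp
  then show ?case using less.prems by (auto simp: shifts_above_def)
qed

lemma real_gap_below:
  fixes b :: real
  assumes "finite V"
  shows "\<exists>v<b. \<forall>w\<in>V. w < b \<longrightarrow> w < v"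
proof (cases "{w \<in> V. w < b} = {}")
  case True
  then show ?thesis using lt_ex[of b] by blast
next
  case False
  let ?M = "Max {w \<in> V. w < b}"
  have fin: "finite {w \<in> V. w < b}" using assms by simp
  then have "?M < b" using Max_in False by blast
  then obtain v where "?M < v" "v < b" using dense by blast
  then show ?thesis using Max_ge[OF fin] by (metis (mono_tags, lifting) le_less_trans mem_Collect_eq)
qed

lemma real_with_card_above:
  fixes b :: real
  assumes "finite V" "b \<notin> V" "card {w \<in> V. b < w} \<le> c" "c \<le> card V"
  shows "\<exists>v<b. v \<notin> V \<and> card {w \<in> V. v < w} = c"
  using assms(3,4)
proof (induction c rule: dec_induct)
  case base
  obtain v where v: "v < b" "\<forall>w\<in>V. w < b \<longrightarrow> w < v" using real_gap_below[OF assms(1)] by blast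
  then have "{w \<in> V. v < w} = {w \<in> V. b < w}" using assms(2) by (auto, metis linorder_neqE_linordered_idom order.asym)
  then show ?case using v by (metis order.irrefl)
next
  case (step c)
  then obtain v where v: "v < b" "v \<notin> V" "card {w \<in> V. v < w} = c" by auto
  have "{w \<in> V. w < v} \<noteq> {}"
  proof
    assume "{w \<in> V. w < v} = {}"
    then have "{w \<in> V. v < w} = V" using v(2) by (auto, metis linorder_neqE_linordered_idom)
    then show False using v(3) step by simp
  qed
  moreover have fin: "finite {w \<in> V. w < v}" using assms by simp
  define m where "m = Max {w \<in> V. w < v}"
  ultimately have m: "m \<in> V" "m < v" using Max_in[OF fin] by (auto simp: m_def)
  have m_max: "w \<le> m" if "w \<in> V" "w < v" for w using Max_ge[OF fin] that by (simp add: m_def)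
  obtain u where u: "u < m" "\<forall>w\<in>V. w < m \<longrightarrow> w < u" using real_gap_below[OF assms(1)] by blast
  have "u < w \<longleftrightarrow> w = m \<or> v < w" if "w \<in> V" for w
  proof (cases w v rule: linorder_cases)
    case less
    then have "w \<le> m" using m_max that by blast
    then show ?thesis using u that less by (cases "w = m") (simp, metis less_le order.asym)
  next
    case equal
    then show ?thesis using v(2) that by simp
  next
    case greater
    then show ?thesis using u m by simp
  qed
  then have "{w \<in> V. u < w} = insert m {w \<in> V. v < w}" using m by auto
  then have "card {w \<in> V. u < w} = Suc c" using m v assms(1) by simp
  moreover have "u \<notin> V" using u by auto
  ultimately show ?case using u m v by (intro exI[of _ u]) auto
qed

lemma inj_on_dominant_shifts:
  assumes "dominant r n x"
  shows "inj_on (\<lambda>(i, k). x i - real k) ({1..n} \<times> {1..r})"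
proof -
  have neq: "x i - real k \<noteq> x j - real l"
    if "i \<in> {1..n}" "j \<in> {1..n}" "k \<in> {1..r}" "l \<in> {1..r}" "i < j" for i j k l
  proof
    assume eq: "x i - real k = x j - real l"
    have "x j < x i" using dominant_less[OF assms, of i j] that by simp
    then have "l < k" using eq by simp
    then have "x i - x j = real (k - l)" using eq by (simp add: of_nat_diff)
    moreover have "1 \<le> k - l" "k - l \<le> r" using \<open>l < k\<close> that(3) by auto
    ultimately show False using dominant_neq[OF assms, of i j "k - l"] that by simp
  qed
  show ?thesis
  proof (rule inj_onI, clarify)
    fix i k j l
    assume *: "i \<in> {1..n}" "k \<in> {1..r}" "j \<in> {1..n}" "l \<in> {1..r}" "x i - real k = x j - real l"
    then have "i = j" using neq[of i j k l] neq[of j i l k] by (metis linorder_neqE_nat)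
    then show "i = j \<and> k = l" using *(5) by simp
  qed
qed

lemma dominant_point_of_heights:
  assumes "dyck_heights r n h"
  shows "\<exists>x. dominant r n x \<and> (\<forall>j\<in>{1..n}. card (shifts_above r x j) = h j)"
  using assms
proof (induction n)
  case 0
  then show ?case by (auto simp: dominant_def)
next
  case (Suc n)
  have "dyck_heights r n h" using Suc.prems by (auto simp: dyck_heights_def)
  then obtain x where x: "dominant r n x" "\<forall>j\<in>{1..n}. card (shifts_above r x j) = h j" using Suc.IH by blast
  let ?f = "\<lambda>(i, k). x i - real k"
  define V where "V = ?f ` ({1..n} \<times> {1..r})"
  note inj = inj_on_dominant_shifts[OF x(1)]
  have finV: "finite V" by (simp add: V_def)
  have cardV: "card V = r * n" unfolding V_def by (subst card_image[OF inj]) (simp add: card_cartesian_product)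
  have above: "card {p \<in> {1..n} \<times> {1..r}. ?f p > v} = card {w \<in> V. v < w}" for v
  proof -
    have "{w \<in> V. v < w} = ?f ` {p \<in> {1..n} \<times> {1..r}. ?f p > v}" by (auto simp: V_def)
    moreover have "inj_on ?f {p \<in> {1..n} \<times> {1..r}. ?f p > v}" using inj by (rule inj_on_subset) auto
    ultimately show ?thesis by (simp add: card_image)
  qed
  have le: "h (Suc n) \<le> card V" using Suc.prems cardV by (simp add: dyck_heights_def)
  have "\<exists>v. (n > 0 \<longrightarrow> v < x n) \<and> v \<notin> V \<and> card {w \<in> V. v < w} = h (Suc n)"
  proof (cases "n = 0")
    case True
    then show ?thesis using le by (auto simp: V_def)
  next
    case False
    have "{p \<in> {1..n} \<times> {1..r}. ?f p > x n} = shifts_above r x n"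
      by (auto simp: shifts_above_def nat_less_le)
    then have "card {w \<in> V. x n < w} = h n" using x(2) False above[of "x n"] by auto
    also have "\<dots> \<le> h (Suc n)"
    proof -
      have "h (Suc (n - 1)) \<le> h (Suc n)" using Suc.prems unfolding dyck_heights_def by (meson diff_le_self lessI)
      then show ?thesis using False by simp
    qed
    finally have "card {w \<in> V. x n < w} \<le> h (Suc n)" .
    moreover have "x n \<notin> V"
    proof
      assume "x n \<in> V"
      then obtain i k where ik: "i \<in> {1..n}" "k \<in> {1..r}" "x n = x i - real k" by (auto simp: V_def)
      then have "i < n" by (cases "i = n") auto
      then show False using dominant_neq[OF x(1), of i n k] ik by simp
    qed
    ultimately show ?thesis using real_with_card_above[OF finV _ _ le] by blast
  qed
  then obtain v where v: "n > 0 \<Longrightarrow> v < x n" "v \<notin> V" "card {w \<in> V. v < w} = h (Suc n)" by blast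
  have vless: "v < x i" if "i \<in> {1..n}" for i
  proof -
    have "x n \<le> x i" using dominant_le[OF x(1), of i n] that by simp
    then show ?thesis using v(1) that by simp
  qed
  let ?y = "x(Suc n := v)"
  have "dominant r (Suc n) ?y"
    unfolding dominant_def
  proof (intro conjI allI impI)
    fix i j assume "1 \<le> i" "i < j" "j \<le> Suc n"
    then show "?y j < ?y i" using dominant_less[OF x(1), of i j] vless[of i] by simp
  next
    fix i j k assume *: "1 \<le> i" "i < j" "j \<le> Suc n" "1 \<le> k" "k \<le> r"
    have "x i - real k \<in> V" if "i \<le> n" using that * by (auto simp: V_def)
    then have "x i - v \<noteq> real k" if "i \<le> n" using that v(2) by (auto simp: algebra_simps)
    then show "?y i - ?y j \<noteq> real k" using dominant_neq[OF x(1), of i j k] * by simp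
  qed
  moreover have "card (shifts_above r ?y j) = h j" if "j \<in> {1..Suc n}" for j
  proof (cases "j = Suc n")
    case True
    have "shifts_above r ?y j = {p \<in> {1..n} \<times> {1..r}. ?f p > v}"
      using True by (intro set_eqI) (auto simp: shifts_above_def)
    then show ?thesis using above v(3) True by simp
  next
    case False
    then have "shifts_above r ?y j = shifts_above r x j" using that by (auto simp: shifts_above_def)
    then show ?thesis using x(2) that False by simp
  qed
  ultimately show ?case by blast
qed

section \<open>Regions as sign classes\<close>

definition same_side :: "nat \<Rightarrow> nat \<Rightarrow> (nat \<Rightarrow> real) \<Rightarrow> (nat \<Rightarrow> real) \<Rightarrow> bool" where
  "same_side r n x y \<longleftrightarrow> (\<forall>i\<in>{1..n}. \<forall>j\<in>{1..n}. \<forall>a\<in>{- int r..int r}. i \<noteq> j \<longrightarrow>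
     (x i - x j > of_int a \<longleftrightarrow> y i - y j > of_int a))"

definition generic :: "nat \<Rightarrow> nat \<Rightarrow> (nat \<Rightarrow> real) set" where
  "generic r n = ({1..n} \<rightarrow>\<^sub>E UNIV) - \<Union>(catalan_arrangement r n)"

lemma same_sideD:
  assumes "same_side r n x y" "i \<in> {1..n}" "j \<in> {1..n}" "a \<in> {- int r..int r}" "i \<noteq> j"
  shows "x i - x j > of_int a \<longleftrightarrow> y i - y j > of_int a"
  using assms unfolding same_side_def by blast

lemma same_side_less_iff:
  assumes "same_side r n x y" "i \<in> {1..n}" "j \<in> {1..n}" "i \<noteq> j"
  shows "x j < x i \<longleftrightarrow> y j < y i"
  using same_sideD[OF assms(1-3) _ assms(4), of 0] by simp

lemma permutes_pair:
  assumes "\<pi> permutes S" "i \<in> S" "j \<in> S" "i \<noteq> j"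
  shows "\<pi> i \<in> S" "\<pi> j \<in> S" "\<pi> i \<noteq> \<pi> j"
  using permutes_in_image[OF assms(1)] permutes_inj[OF assms(1), THEN inj_eq] assms(2-4) by simp_all

lemma genericI:
  assumes "x \<in> {1..n} \<rightarrow>\<^sub>E UNIV"
    and "\<And>i j a. i \<in> {1..n} \<Longrightarrow> j \<in> {1..n} \<Longrightarrow> a \<in> {- int r..int r} \<Longrightarrow> i \<noteq> j \<Longrightarrow> x i - x j \<noteq> of_int a"
  shows "x \<in> generic r n"
proof -
  have False if H: "x \<in> H" "H \<in> catalan_arrangement r n" for H
  proof -
    obtain i j a where "H = {x \<in> {1..n} \<rightarrow>\<^sub>E UNIV. x i - x j = of_int a}" "1 \<le> i" "i < j" "j \<le> n"
      "a \<in> {- int r..int r}" using H(2) unfolding catalan_arrangement_def by blast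
    then show False using H(1) assms(2)[of i j a] by simp
  qed
  then show ?thesis using assms(1) unfolding generic_def by blast
qed

lemma genericD:
  assumes "x \<in> generic r n" "i \<in> {1..n}" "j \<in> {1..n}" "a \<in> {- int r..int r}" "i \<noteq> j"
  shows "x i - x j \<noteq> of_int a"
proof -
  have less: "x i - x j \<noteq> of_int a" if "1 \<le> i" "i < j" "j \<le> n" "a \<in> {- int r..int r}" for i j a
  proof
    assume "x i - x j = of_int a"
    then have "x \<in> {x \<in> {1..n} \<rightarrow>\<^sub>E UNIV. x i - x j = of_int a}" using assms(1) by (simp add: generic_def)
    moreover have "{x \<in> {1..n} \<rightarrow>\<^sub>E UNIV. x i - x j = of_int a} \<in> catalan_arrangement r n"
      unfolding catalan_arrangement_def using that by blast
    ultimately show False using assms(1) unfolding generic_def by blast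
  qed
  show ?thesis
  proof (cases "i < j")
    case True
    then show ?thesis using less[of i j a] assms by simp
  next
    case False
    then have "x j - x i \<noteq> of_int (- a)" using assms by (intro less) auto
    then show ?thesis by simp
  qed
qed

lemma connected_real_avoiding:
  fixes S :: "real set"
  assumes "connected S" "a \<in> S" "b \<in> S" "c \<notin> S"
  shows "c < a \<longleftrightarrow> c < b"
  using assms(4) connectedD_interval[OF assms(1,2,3), of c] connectedD_interval[OF assms(1,3,2), of c]
  by linarith

lemma generic_component_iff:
  assumes x: "x \<in> generic r n"
  shows "connected_component_of (subtopology (powertop_real {1..n}) (generic r n)) x y \<longleftrightarrow>
    y \<in> generic r n \<and> same_side r n x y" (is "connected_component_of ?X x y \<longleftrightarrow> ?R")
proof
  assume "connected_component_of ?X x y"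
  then obtain T where T: "connectedin ?X T" "x \<in> T" "y \<in> T" by (auto simp: connected_component_of_def)
  have sub: "T \<subseteq> generic r n" using T(1) by (simp add: connectedin_subtopology)
  have "x i - x j > of_int a \<longleftrightarrow> y i - y j > of_int a"
    if ij: "i \<in> {1..n}" "j \<in> {1..n}" "a \<in> {- int r..int r}" "i \<noteq> j" for i j a
  proof -
    have "continuous_map ?X euclideanreal (\<lambda>x. x i - x j)"
      using ij by (intro continuous_map_diff continuous_map_from_subtopology continuous_map_product_projection) auto
    then have conn: "connected ((\<lambda>x. x i - x j) ` T)"
      using connectedin_continuous_map_image[OF _ T(1)] connectedin_iff_connected by blast
    have "of_int a \<notin> (\<lambda>x. x i - x j) ` T"
    proof
      assume "of_int a \<in> (\<lambda>x. x i - x j) ` T"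
      then obtain z where "z \<in> T" "z i - z j = of_int a" by force
      then show False using genericD[OF _ ij] sub by blast
    qed
    then show ?thesis using connected_real_avoiding[OF conn] T(2,3) by blast
  qed
  then show ?R using T(3) sub unfolding same_side_def by blast
next
  assume R: ?R
  define g where "g t = (\<lambda>i\<in>{1..n}. (1 - t) * x i + t * y i)" for t :: real
  have "g t \<in> generic r n" if t: "t \<in> {0..1}" for t
  proof (rule genericI)
    show "g t \<in> {1..n} \<rightarrow>\<^sub>E UNIV" by (simp add: g_def)
    fix i j a assume ij: "i \<in> {1..n}" "j \<in> {1..n}" "a \<in> {- int r..int r}" "i \<noteq> j"
    let ?u = "x i - x j - of_int a" and ?w = "y i - y j - of_int a"
    have nz: "?u \<noteq> 0" "?w \<noteq> 0" using genericD[OF x ij] genericD[OF _ ij, of y] R by simp_all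
    have "?u > 0 \<longleftrightarrow> ?w > 0" using same_sideD[OF _ ij] R by simp
    then have "(1 - t) * ?u + t * ?w \<noteq> 0"
    proof (cases "?u > 0")
      case True
      then have "?w > 0" using \<open>?u > 0 \<longleftrightarrow> ?w > 0\<close> by blast
      then show ?thesis
        using True t convex_bound_lt[of "- ?u" 0 "- ?w" "1 - t" t] by (simp add: algebra_simps)
    next
      case False
      then have neg: "?u < 0" "?w < 0" using nz \<open>?u > 0 \<longleftrightarrow> ?w > 0\<close> by linarith+
      then show ?thesis using t convex_bound_lt[of ?u 0 ?w "1 - t" t] by (simp add: algebra_simps)
    qed
    moreover have "g t i - g t j - of_int a = (1 - t) * ?u + t * ?w"
      using ij by (simp add: g_def algebra_simps)
    ultimately show "g t i - g t j \<noteq> of_int a" by linarith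
  qed
  moreover have "continuous_map (top_of_set {0..1}) (powertop_real {1..n}) g"
    unfolding continuous_map_componentwise
    by (auto simp: g_def intro!: continuous_intros)
  ultimately have "continuous_map (top_of_set {0..1}) ?X g"
    by (intro continuous_map_into_subtopology) auto
  moreover have "connectedin (top_of_set {0..1::real}) {0..1}" by (simp add: connectedin_subtopology)
  ultimately have "connectedin ?X (g ` {0..1})" by (rule connectedin_continuous_map_image)
  moreover have "g 0 = x" "g 1 = y"
    using x R by (auto simp: g_def generic_def PiE_def extensional_def fun_eq_iff)
  ultimately show "connected_component_of ?X x y"
    unfolding connected_component_of_def
    by (metis atLeastAtMost_iff image_eqI order.refl zero_le_one)
qed

lemma regions_eq:
  "regions n (catalan_arrangement r n) = (\<lambda>x. {y \<in> generic r n. same_side r n x y}) ` generic r n"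
proof -
  have "generic r n \<subseteq> {1..n} \<rightarrow>\<^sub>E UNIV" by (auto simp: generic_def)
  then have "topspace (subtopology (powertop_real {1..n}) (generic r n)) = generic r n"
    by (simp add: inf_absorb2)
  then show ?thesis
    unfolding regions_def connected_components_of_def generic_def[symmetric]
    using generic_component_iff[of _ r n] by (intro image_cong) auto
qed

lemma same_side_refl: "same_side r n x x"
  by (simp add: same_side_def)

lemma same_side_sym: "same_side r n x y \<Longrightarrow> same_side r n y x"
  by (simp add: same_side_def)

lemma same_side_trans: "same_side r n x y \<Longrightarrow> same_side r n y z \<Longrightarrow> same_side r n x z"
  by (simp add: same_side_def)

lemma regionE:
  assumes "\<Delta> \<in> regions n (catalan_arrangement r n)"
  obtains x where "x \<in> \<Delta>"
  using assms same_side_refl unfolding regions_eq by blast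

lemma region_eq:
  assumes "\<Delta> \<in> regions n (catalan_arrangement r n)" "x \<in> \<Delta>"
  shows "x \<in> generic r n" "\<Delta> = {y \<in> generic r n. same_side r n x y}"
  using assms same_side_sym same_side_trans unfolding regions_eq by blast+

definition sorts :: "nat \<Rightarrow> (nat \<Rightarrow> nat) \<Rightarrow> (nat \<Rightarrow> real) \<Rightarrow> bool" where
  "sorts n \<pi> x \<longleftrightarrow> \<pi> permutes {1..n} \<and> (\<forall>i\<in>{1..n}. \<forall>j\<in>{1..n}. i < j \<longrightarrow> x (\<pi> i) > x (\<pi> j))"

lemma sorting_permutation_exists:
  assumes "inj_on x {1..n}"
  shows "\<exists>\<pi>. sorts n \<pi> x"
proof -
  define \<rho> where "\<rho> i = (if i \<in> {1..n} then card {j \<in> {1..n}. x i \<le> x j} else i)" for i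
  have less: "\<rho> i < \<rho> j" if "i \<in> {1..n}" "j \<in> {1..n}" "x j < x i" for i j
  proof -
    have "{l \<in> {1..n}. x i \<le> x l} \<subseteq> {l \<in> {1..n}. x j \<le> x l}" using that by auto
    moreover have "j \<in> {l \<in> {1..n}. x j \<le> x l} - {l \<in> {1..n}. x i \<le> x l}" using that by simp
    ultimately have "{l \<in> {1..n}. x i \<le> x l} \<subset> {l \<in> {1..n}. x j \<le> x l}" by blast
    then show ?thesis using that by (simp add: \<rho>_def psubset_card_mono)
  qed
  have "inj_on \<rho> {1..n}"
  proof (rule inj_onI, rule ccontr)
    fix i j assume ij: "i \<in> {1..n}" "j \<in> {1..n}" "\<rho> i = \<rho> j" "i \<noteq> j"
    then have "x i \<noteq> x j" using assms by (auto dest: inj_onD)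
    then show False using less[of i j] less[of j i] ij by linarith
  qed
  moreover have "\<rho> ` {1..n} \<subseteq> {1..n}"
  proof
    fix k assume "k \<in> \<rho> ` {1..n}"
    then obtain i where i: "i \<in> {1..n}" "k = card {j \<in> {1..n}. x i \<le> x j}" by (auto simp: \<rho>_def)
    have "card {j \<in> {1..n}. x i \<le> x j} \<le> card {1..n}" by (intro card_mono) auto
    moreover have "card {j \<in> {1..n}. x i \<le> x j} > 0" using i by (auto simp: card_gt_0_iff)
    ultimately show "k \<in> {1..n}" using i by simp
  qed
  ultimately have "bij_betw \<rho> {1..n} {1..n}" by (simp add: bij_betw_def endo_inj_surj)
  then have perm: "\<rho> permutes {1..n}" by (intro bij_imp_permutes) (auto simp: \<rho>_def)
  have "x (inv \<rho> j) < x (inv \<rho> i)" if "i \<in> {1..n}" "j \<in> {1..n}" "i < j" for i j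
  proof (rule ccontr)
    assume "\<not> x (inv \<rho> j) < x (inv \<rho> i)"
    moreover have "inv \<rho> i \<in> {1..n}" "inv \<rho> j \<in> {1..n}"
      using permutes_pair[OF permutes_inv[OF perm] that(1,2)] that(3) by simp_all
    ultimately have "\<rho> (inv \<rho> j) \<le> \<rho> (inv \<rho> i)" using less[of "inv \<rho> j" "inv \<rho> i"]
      by (cases "x (inv \<rho> j) = x (inv \<rho> i)") (simp_all add: \<rho>_def)
    then show False using that permutes_inverses(1)[OF perm] by simp
  qed
  then show ?thesis using permutes_inv[OF perm] by (auto simp: sorts_def)
qed

lemma sorting_permutation_unique:
  assumes "sorts n \<pi> x" "sorts n \<sigma> x"
  shows "\<pi> = \<sigma>"
proof -
  have rank: "card {l \<in> {1..n}. x (\<tau> i) \<le> x l} = i" if "sorts n \<tau> x" "i \<in> {1..n}" for \<tau> i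
  proof -
    have perm: "\<tau> permutes {1..n}" using that by (simp add: sorts_def)
    have dec: "x (\<tau> b) < x (\<tau> a)" if "a \<in> {1..n}" "b \<in> {1..n}" "a < b" for a b
      using \<open>sorts n \<tau> x\<close> that unfolding sorts_def by blast
    have "x (\<tau> i) \<le> x (\<tau> j) \<longleftrightarrow> j \<le> i" if "j \<in> {1..n}" for j
      using dec[OF \<open>i \<in> {1..n}\<close> that] dec[OF that \<open>i \<in> {1..n}\<close>] by (cases i j rule: linorder_cases) simp_all
    moreover have "{1..i} = {j \<in> {1..n}. j \<le> i}" using \<open>i \<in> {1..n}\<close> by auto
    ultimately have "{l \<in> \<tau> ` {1..n}. x (\<tau> i) \<le> x l} = \<tau> ` {1..i}" by blast
    then show ?thesis
      using permutes_image[OF perm] permutes_inj_on[OF perm] by (simp add: card_image)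
  qed
  show ?thesis
  proof
    fix i
    show "\<pi> i = \<sigma> i"
    proof (cases "i \<in> {1..n}")
      case False
      then show ?thesis using assms permutes_not_in unfolding sorts_def by metis
    next
      case True
      have perm: "\<pi> permutes {1..n}" "\<sigma> permutes {1..n}" using assms by (simp_all add: sorts_def)
      then have "\<pi> i \<in> \<sigma> ` {1..n}" using True permutes_in_image[OF perm(1)] permutes_image[OF perm(2)] by blast
      then obtain j where j: "j \<in> {1..n}" "\<sigma> j = \<pi> i" by force
      then have "j = i" using rank[OF assms(1) True] rank[OF assms(2) j(1)] by simp
      then show ?thesis using j by simp
    qed
  qed
qed

lemma generic_inj_on: "x \<in> generic r n \<Longrightarrow> inj_on x {1..n}"
  using genericD[of x r n _ _ 0] by (force simp: inj_on_def)

lemma sorts_same_side: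
  assumes "same_side r n x y" "sorts n \<pi> x"
  shows "sorts n \<pi> y"
  unfolding sorts_def
proof (intro conjI ballI impI)
  show perm: "\<pi> permutes {1..n}" using assms(2) by (simp add: sorts_def)
  fix i j assume ij: "i \<in> {1..n}" "j \<in> {1..n}" "i < j"
  then have "x (\<pi> j) < x (\<pi> i) \<longleftrightarrow> y (\<pi> j) < y (\<pi> i)"
    using same_side_less_iff[OF assms(1)] permutes_pair[OF perm ij(1,2)] by simp
  then show "y (\<pi> j) < y (\<pi> i)" using assms(2) ij by (simp add: sorts_def)
qed

lemma region_perm_eq_iff:
  assumes "\<Delta> \<in> regions n (catalan_arrangement r n)" "x \<in> \<Delta>"
  shows "region_perm n \<Delta> = \<pi> \<longleftrightarrow> sorts n \<pi> x"
proof -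
  note \<Delta> = region_eq[OF assms]
  have all: "(\<sigma> permutes {1..n} \<and> (\<forall>x\<in>\<Delta>. \<forall>i\<in>{1..n}. \<forall>j\<in>{1..n}. i < j \<longrightarrow> x (\<sigma> i) > x (\<sigma> j))) \<longleftrightarrow> sorts n \<sigma> x" for \<sigma>
  proof -
    have "sorts n \<sigma> y" if "sorts n \<sigma> x" "y \<in> \<Delta>" for y
      using sorts_same_side[OF _ that(1)] that(2) \<Delta>(2) by blast
    then show ?thesis using assms(2) unfolding sorts_def by blast
  qed
  obtain \<tau> where \<tau>: "sorts n \<tau> x" using sorting_permutation_exists generic_inj_on \<Delta>(1) by blast
  then have "region_perm n \<Delta> = \<tau>"
    unfolding region_perm_def all using sorting_permutation_unique by (intro the_equality)
  then show ?thesis using \<tau> sorting_permutation_unique by blast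
qed

lemma dominant_perm_act:
  assumes "x \<in> generic r n" "sorts n \<pi> x"
  shows "dominant r n (perm_act n \<pi> x)"
proof -
  have perm: "\<pi> permutes {1..n}" using assms by (simp add: sorts_def)
  have "x (\<pi> i) - x (\<pi> j) \<noteq> real k" if "1 \<le> i" "i < j" "j \<le> n" "1 \<le> k" "k \<le> r" for i j k
  proof -
    have "\<pi> i \<in> {1..n}" "\<pi> j \<in> {1..n}" "\<pi> i \<noteq> \<pi> j"
      using permutes_pair[OF perm, of i j] that by simp_all
    then show ?thesis using genericD[OF assms(1), of "\<pi> i" "\<pi> j" "int k"] that by simp
  qed
  moreover have "x (\<pi> j) < x (\<pi> i)" if "1 \<le> i" "i < j" "j \<le> n" for i j
    using assms(2) that by (simp add: sorts_def)
  ultimately show ?thesis by (simp add: dominant_def perm_act_def)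
qed

lemma same_side_perm_act:
  assumes "\<pi> permutes {1..n}"
  shows "same_side r n (perm_act n \<pi> x) (perm_act n \<pi> y) \<longleftrightarrow> same_side r n x y"
proof -
  have imp: "same_side r n (perm_act n \<tau> x) (perm_act n \<tau> y)" if "same_side r n x y" "\<tau> permutes {1..n}" for \<tau> x y
    unfolding same_side_def
  proof (intro ballI impI)
    fix i j a assume ij: "i \<in> {1..n}" "j \<in> {1..n}" "a \<in> {- int r..int r}" "i \<noteq> j"
    show "of_int a < perm_act n \<tau> x i - perm_act n \<tau> x j \<longleftrightarrow> of_int a < perm_act n \<tau> y i - perm_act n \<tau> y j"
      using same_sideD[OF that(1) permutes_pair(1,2)[OF that(2)] ij(3) permutes_pair(3)[OF that(2)]] ij
      by (simp add: perm_act_def)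
  qed
  have cancel: "same_side r n (perm_act n (inv \<pi>) (perm_act n \<pi> x)) (perm_act n (inv \<pi>) (perm_act n \<pi> y)) \<longleftrightarrow> same_side r n x y"
  proof -
    have "perm_act n (inv \<pi>) (perm_act n \<pi> z) i = z i" if "i \<in> {1..n}" for z i
      using that permutes_in_image[OF permutes_inv[OF assms], of i] permutes_inverses(1)[OF assms]
      by (simp add: perm_act_def)
    then show ?thesis unfolding same_side_def by simp
  qed
  show ?thesis using imp[of _ _ \<pi>] imp[of "perm_act n \<pi> x" "perm_act n \<pi> y" "inv \<pi>"] cancel assms permutes_inv by blast
qed

lemma dominant_generic:
  assumes "dominant r n x" "i \<in> {1..n}" "j \<in> {1..n}" "a \<in> {- int r..int r}" "i \<noteq> j"
  shows "x i - x j \<noteq> of_int a"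
proof -
  have less: "x i - x j \<noteq> of_int a" if "1 \<le> i" "i < j" "j \<le> n" "a \<in> {- int r..int r}" for i j a
  proof (cases "a \<ge> 1")
    case True
    then obtain k where "a = int k" using zero_le_imp_eq_int[of a] by auto
    then show ?thesis using dominant_neq[OF assms(1), of i j k] that True by simp
  next
    case False
    then have "(of_int a :: real) \<le> 0" by simp
    then show ?thesis using dominant_less[OF assms(1) that(1-3)] by linarith
  qed
  show ?thesis
  proof (cases "i < j")
    case True
    then show ?thesis using less[of i j a] assms by simp
  next
    case False
    then have "x j - x i \<noteq> of_int (- a)" using assms by (intro less) auto
    then show ?thesis by simp
  qed
qed

lemma same_side_if_dominant_agree:
  assumes x: "dominant r n x" and y: "dominant r n y"
    and agree: "\<And>i j k. 1 \<le> i \<Longrightarrow> i < j \<Longrightarrow> j \<le> n \<Longrightarrow> 1 \<le> k \<Longrightarrow> k \<le> r \<Longrightarrow>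
      x i - x j > real k \<longleftrightarrow> y i - y j > real k"
  shows "same_side r n x y"
  unfolding same_side_def
proof (intro ballI impI)
  fix i j and a :: int
  assume ij: "i \<in> {1..n}" "j \<in> {1..n}" "a \<in> {- int r..int r}" "i \<noteq> j"
  have up: "x i - x j > of_int a \<longleftrightarrow> y i - y j > of_int a"
    if "i \<in> {1..n}" "j \<in> {1..n}" "a \<in> {- int r..int r}" "i < j" for i j a
  proof (cases "a \<ge> 1")
    case True
    then obtain k where "a = int k" using zero_le_imp_eq_int[of a] by auto
    then show ?thesis using agree[of i j k] that True by simp
  next
    case False
    then have "(of_int a :: real) \<le> 0" by simp
    moreover have "x j < x i" "y j < y i" using dominant_less[OF x, of i j] dominant_less[OF y, of i j] that by simp_all
    ultimately show ?thesis by linarith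
  qed
  show "x i - x j > of_int a \<longleftrightarrow> y i - y j > of_int a"
  proof (cases "i < j")
    case True
    then show ?thesis using up ij by blast
  next
    case False
    then have "j < i" using ij by simp
    have ne: "z j - z i \<noteq> of_int (- a)" if "dominant r n z" for z
      using dominant_generic[OF that ij(2,1), of "- a"] ij(3,4) by simp
    have "x j - x i > of_int (- a) \<longleftrightarrow> y j - y i > of_int (- a)" using up[of j i "- a"] \<open>j < i\<close> ij by simp
    then show ?thesis using ne[OF x] ne[OF y] by simp linarith
  qed
qed

lemma dominant_same_side_iff_heights:
  assumes x: "dominant r n x" and y: "dominant r n y"
  shows "same_side r n x y \<longleftrightarrow> point_heights r n x = point_heights r n y"
proof
  assume same: "same_side r n x y"
  have "shifts_above r x j = shifts_above r y j" if "j \<in> {1..n}" for j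
  proof -
    have "x i - x j > real k \<longleftrightarrow> y i - y j > real k" if "i \<in> {1..<j}" "k \<in> {1..r}" for i k
    proof -
      have "int k \<in> {- int r..int r}" "i \<in> {1..n}" "i \<noteq> j" using that \<open>j \<in> {1..n}\<close> by auto
      then show ?thesis using same_sideD[OF same _ \<open>j \<in> {1..n}\<close>, of i "int k"] by simp
    qed
    then have "x i - real k > x j \<longleftrightarrow> y i - real k > y j" if "i \<in> {1..<j}" "k \<in> {1..r}" for i k
      using that by (simp add: less_diff_eq add.commute)
    then show ?thesis unfolding shifts_above_def by blast
  qed
  then show "point_heights r n x = point_heights r n y"
    by (auto simp: point_heights_dominant[OF x] point_heights_dominant[OF y] simp del: upt_Suc)
next
  assume "point_heights r n x = point_heights r n y"
  then have "\<forall>j\<in>set [1..<Suc n]. card (shifts_above r x j) = card (shifts_above r y j)"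
    unfolding point_heights_dominant[OF x] point_heights_dominant[OF y] map_eq_conv .
  then show "same_side r n x y"
    by (intro same_side_if_dominant_agree[OF x y] dominant_agree_if_heights_eq[OF x y]) auto
qed

section \<open>The bijection\<close>

lemma dominant_dyck_path:
  assumes "dominant r n x"
  shows "\<exists>!P. P \<in> dyck_paths r n \<and> height_sequence n P = map real (point_heights r n x)"
  using dyck_path_of_heights[OF dyck_heights_dominant[OF assms]]
  by (simp add: point_heights_dominant[OF assms] comp_def del: upt_Suc)

lemma region_heights_perm_act:
  assumes \<Delta>: "\<Delta> \<in> regions n (catalan_arrangement r n)" "x \<in> \<Delta>" and "sorts n \<pi> x"
  shows "region_heights r n (perm_act n \<pi> ` \<Delta>) = point_heights r n (perm_act n \<pi> x)"
proof -
  have "(SOME z. z \<in> perm_act n \<pi> ` \<Delta>) \<in> perm_act n \<pi> ` \<Delta>"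
    unfolding some_in_eq using \<Delta>(2) by blast
  then obtain w where w: "(SOME z. z \<in> perm_act n \<pi> ` \<Delta>) = perm_act n \<pi> w" "w \<in> \<Delta>" by (rule imageE)
  have "same_side r n x w" using w(2) region_eq(2)[OF \<Delta>] by simp
  then have "same_side r n (perm_act n \<pi> x) (perm_act n \<pi> w)"
    using assms(3) by (simp add: sorts_def same_side_perm_act)
  moreover have "sorts n \<pi> w" using \<open>same_side r n x w\<close> assms(3) by (rule sorts_same_side)
  ultimately show ?thesis
    using dominant_same_side_iff_heights[OF dominant_perm_act[OF region_eq(1)[OF \<Delta>] assms(3)]
        dominant_perm_act[OF region_eq(1)[OF \<Delta>(1) w(2)]]] w(1)
    by (simp add: region_heights_def)
qed

lemma Phi_eq_iff:
  assumes \<Delta>: "\<Delta> \<in> regions n (catalan_arrangement r n)" "x \<in> \<Delta>"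
  shows "Phi r n \<Delta> = (\<pi>, P) \<longleftrightarrow> sorts n \<pi> x \<and> P \<in> dyck_paths r n \<and>
    height_sequence n P = map real (point_heights r n (perm_act n \<pi> x))"
proof (cases "sorts n \<pi> x")
  case False
  then show ?thesis using region_perm_eq_iff[OF \<Delta>] by (simp add: Phi_def)
next
  case True
  let ?Q = "\<lambda>P. P \<in> dyck_paths r n \<and> height_sequence n P = map real (point_heights r n (perm_act n \<pi> x))"
  have perm: "region_perm n \<Delta> = \<pi>" using region_perm_eq_iff[OF \<Delta>] True by simp
  have "region_path r n \<Delta> = (THE P. ?Q P)"
    by (simp add: region_path_def path_of_id_region_def perm region_heights_perm_act[OF \<Delta> True])
  moreover have ex1: "\<exists>!P. ?Q P"
    using dominant_dyck_path[OF dominant_perm_act[OF region_eq(1)[OF \<Delta>] True]] .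
  ultimately have "region_path r n \<Delta> = P \<longleftrightarrow> ?Q P"
    using theI'[OF ex1] the1_equality[OF ex1, of P] by metis
  then show ?thesis using perm True by (simp add: Phi_def)
qed

lemma perm_act_id: "x \<in> {1..n} \<rightarrow>\<^sub>E UNIV \<Longrightarrow> perm_act n id x = x"
  by (simp add: perm_act_def PiE_def extensional_restrict)

lemma region_of_generic:
  assumes "x \<in> generic r n"
  shows "\<exists>\<Delta>\<in>regions n (catalan_arrangement r n). x \<in> \<Delta>"
  using assms same_side_refl unfolding regions_eq by blast

lemma region_of_perm_and_path:
  assumes \<pi>: "\<pi> permutes {1..n}" and P: "P \<in> dyck_paths r n"
  shows "\<exists>\<Delta>\<in>regions n (catalan_arrangement r n). Phi r n \<Delta> = (\<pi>, P)"
proof -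
  obtain h where h: "dyck_heights r n h" "height_sequence n P = map (\<lambda>j. real (h j)) [1..<Suc n]"
    using dyck_path_heights[OF P] by blast
  obtain y0 where y0: "dominant r n y0" "\<forall>j\<in>{1..n}. card (shifts_above r y0 j) = h j"
    using dominant_point_of_heights[OF h(1)] by blast
  define y where "y = restrict y0 {1..n}"
  have dom: "dominant r n y" using y0(1) by (simp add: dominant_def y_def)
  have "shifts_above r y j = shifts_above r y0 j" if "j \<in> {1..n}" for j
    using that by (intro set_eqI) (auto simp: shifts_above_def y_def)
  then have heights: "point_heights r n y = map h [1..<Suc n]"
    unfolding point_heights_dominant[OF dom] map_eq_conv using y0(2) by (simp del: upt_Suc)
  define x where "x = perm_act n (inv \<pi>) y"
  note inv = permutes_inv[OF \<pi>]
  have x_\<pi>: "x (\<pi> i) = y i" if "i \<in> {1..n}" for i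
    using that permutes_in_image[OF \<pi>, of i] permutes_inverses(2)[OF \<pi>] by (simp add: x_def perm_act_def)
  have "x \<in> generic r n"
  proof (rule genericI)
    show "x \<in> {1..n} \<rightarrow>\<^sub>E UNIV" by (simp add: x_def perm_act_def)
    fix i j a assume ij: "i \<in> {1..n}" "j \<in> {1..n}" "a \<in> {- int r..int r}" "i \<noteq> j"
    show "x i - x j \<noteq> of_int a"
      using dominant_generic[OF dom permutes_pair(1,2)[OF inv ij(1,2,4)] ij(3) permutes_pair(3)[OF inv ij(1,2,4)]] ij
      by (simp add: x_def perm_act_def)
  qed
  then obtain \<Delta> where \<Delta>: "\<Delta> \<in> regions n (catalan_arrangement r n)" "x \<in> \<Delta>"
    using region_of_generic by blast
  have "sorts n \<pi> x" using \<pi> x_\<pi> dominant_less[OF dom] by (simp add: sorts_def)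
  moreover have "perm_act n \<pi> x = y" using x_\<pi> by (auto simp: perm_act_def y_def)
  ultimately have "Phi r n \<Delta> = (\<pi>, P)"
    using P h(2) heights by (simp add: Phi_eq_iff[OF \<Delta>] comp_def del: upt_Suc)
  then show ?thesis using \<Delta>(1) by blast
qed

lemma inj_on_Phi: "inj_on (Phi r n) (regions n (catalan_arrangement r n))"
proof (rule inj_onI)
  fix \<Delta> \<Delta>' assume \<Delta>: "\<Delta> \<in> regions n (catalan_arrangement r n)" and \<Delta>': "\<Delta>' \<in> regions n (catalan_arrangement r n)"
    and eq: "Phi r n \<Delta> = Phi r n \<Delta>'"
  obtain x where x: "x \<in> \<Delta>" using regionE[OF \<Delta>] .
  obtain x' where x': "x' \<in> \<Delta>'" using regionE[OF \<Delta>'] .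
  obtain \<pi> P where "Phi r n \<Delta> = (\<pi>, P)" by (rule prod.exhaust)
  then have *: "sorts n \<pi> x" "height_sequence n P = map real (point_heights r n (perm_act n \<pi> x))"
    "sorts n \<pi> x'" "height_sequence n P = map real (point_heights r n (perm_act n \<pi> x'))"
    using Phi_eq_iff[OF \<Delta> x, of \<pi> P] Phi_eq_iff[OF \<Delta>' x', of \<pi> P] eq by simp_all
  then have "point_heights r n (perm_act n \<pi> x) = point_heights r n (perm_act n \<pi> x')"
    by (simp add: inj_map_eq_map inj_of_nat)
  then have "same_side r n (perm_act n \<pi> x) (perm_act n \<pi> x')"
    using dominant_same_side_iff_heights[OF dominant_perm_act[OF region_eq(1)[OF \<Delta> x] *(1)]
        dominant_perm_act[OF region_eq(1)[OF \<Delta>' x'] *(3)]] by simp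
  then have same: "same_side r n x x'" using *(1) by (simp add: sorts_def same_side_perm_act)
  have "same_side r n x z \<longleftrightarrow> same_side r n x' z" for z
    using same same_side_sym same_side_trans by blast
  then show "\<Delta> = \<Delta>'" using region_eq(2)[OF \<Delta> x] region_eq(2)[OF \<Delta>' x'] by simp
qed

theorem theorem2p6:
  fixes r n :: nat
  assumes "r \<ge> 1" and "n \<ge> 1"
  shows "(\<forall>\<Delta>\<in>regions n (catalan_arrangement r n). region_perm n \<Delta> = id \<longrightarrow>
            (\<forall>x\<in>\<Delta>. \<forall>y\<in>\<Delta>. point_heights r n x = point_heights r n y) \<and>
            (\<forall>x\<in>\<Delta>. \<exists>!P. P \<in> dyck_paths r n \<and> height_sequence n P = map real (point_heights r n x))) \<and>
         bij_betw (Phi r n) (regions n (catalan_arrangement r n))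
           ({\<pi>. \<pi> permutes {1..n}} \<times> dyck_paths r n)"
proof
  show "\<forall>\<Delta>\<in>regions n (catalan_arrangement r n). region_perm n \<Delta> = id \<longrightarrow>
            (\<forall>x\<in>\<Delta>. \<forall>y\<in>\<Delta>. point_heights r n x = point_heights r n y) \<and>
            (\<forall>x\<in>\<Delta>. \<exists>!P. P \<in> dyck_paths r n \<and> height_sequence n P = map real (point_heights r n x))"
  proof (intro ballI impI)
    fix \<Delta> assume \<Delta>: "\<Delta> \<in> regions n (catalan_arrangement r n)" "region_perm n \<Delta> = id"
    have dom: "dominant r n x" if "x \<in> \<Delta>" for x
    proof -
      have x: "x \<in> generic r n" "sorts n id x"
        using region_eq(1)[OF \<Delta>(1) that] region_perm_eq_iff[OF \<Delta>(1) that, of id] \<Delta>(2) by simp_all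
      moreover have "x \<in> {1..n} \<rightarrow>\<^sub>E UNIV" using x(1) by (simp add: generic_def)
      ultimately show ?thesis using dominant_perm_act[OF x] by (simp only: perm_act_id)
    qed
    have "point_heights r n x = point_heights r n y" if xy: "x \<in> \<Delta>" "y \<in> \<Delta>" for x y
    proof -
      have "same_side r n x y" using region_eq(2)[OF \<Delta>(1) xy(1)] xy(2) by simp
      then show ?thesis using dominant_same_side_iff_heights[OF dom[OF xy(1)] dom[OF xy(2)]] by simp
    qed
    then show "(\<forall>x\<in>\<Delta>. \<forall>y\<in>\<Delta>. point_heights r n x = point_heights r n y) \<and>
        (\<forall>x\<in>\<Delta>. \<exists>!P. P \<in> dyck_paths r n \<and> height_sequence n P = map real (point_heights r n x))"
      by (intro conjI ballI dominant_dyck_path[OF dom])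
  qed
  have "Phi r n ` regions n (catalan_arrangement r n) \<subseteq> {\<pi>. \<pi> permutes {1..n}} \<times> dyck_paths r n"
  proof
    fix z assume "z \<in> Phi r n ` regions n (catalan_arrangement r n)"
    then obtain \<Delta> where \<Delta>: "\<Delta> \<in> regions n (catalan_arrangement r n)" "z = Phi r n \<Delta>" by blast
    obtain x where x: "x \<in> \<Delta>" using regionE[OF \<Delta>(1)] .
    obtain \<pi> P where "z = (\<pi>, P)" by (rule prod.exhaust)
    then show "z \<in> {\<pi>. \<pi> permutes {1..n}} \<times> dyck_paths r n"
      using Phi_eq_iff[OF \<Delta>(1) x, of \<pi> P] \<Delta>(2) by (simp add: sorts_def)
  qed
  moreover have "{\<pi>. \<pi> permutes {1..n}} \<times> dyck_paths r n \<subseteq> Phi r n ` regions n (catalan_arrangement r n)"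
  proof clarify
    fix \<pi> P assume "\<pi> permutes {1..n}" "P \<in> dyck_paths r n"
    then obtain \<Delta> where "\<Delta> \<in> regions n (catalan_arrangement r n)" "Phi r n \<Delta> = (\<pi>, P)"
      using region_of_perm_and_path by blast
    then show "(\<pi>, P) \<in> Phi r n ` regions n (catalan_arrangement r n)" using image_eqI by metis
  qed
  ultimately show "bij_betw (Phi r n) (regions n (catalan_arrangement r n))
      ({\<pi>. \<pi> permutes {1..n}} \<times> dyck_paths r n)"
    using inj_on_Phi unfolding bij_betw_def by blast
qed

end
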